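(* For any integers $r,t\geq 2$, there exist positive constants $C$ and $\delta$ such that, letting $H_{t,t,\dots,t}$ be the subdivision of the complete $r$-partite $r$-uniform hypergraph $K_{t,t,\dots,t}$ (with $r$ parts each of size $t$), we have $\mathrm{ex}(n,H_{t,t,\dots,t})\leq Cn^{2-1/r-\delta}$ for all $n$.
   Context: The complete $r$-partite $r$-uniform hypergraph $K_{t,\dots,t}$ has vertex set the disjoint union of $r$ sets of size $t$, and its edges are all $r$-sets containing exactly one vertex from each part. The subdivision of a hypergraph $F$ is the bipartite graph with parts $V(F)$ and $E(F)$, where $v\in V(F)$ is joined to $e\in E(F)$ if and only if $v\in e$. $\mathrm{ex}(n,H)$ is the largest number of edges in an $n$-vertex graph containing no copy of the graph $H$. *)

theory Defs
  imports Complex_Main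
begin

type_synonym 'a hypergraph = "'a set \<times> 'a set set"

abbreviation hverts :: "'a hypergraph \<Rightarrow> 'a set" where
  "hverts H \<equiv> fst H"

abbreviation hedges :: "'a hypergraph \<Rightarrow> 'a set set" where
  "hedges H \<equiv> snd H"

definition finite_simple_graph :: "'a hypergraph \<Rightarrow> bool" where
  "finite_simple_graph G \<longleftrightarrow>
     finite (hverts G) \<and> (\<forall>e\<in>hedges G. e \<subseteq> hverts G \<and> card e = 2)"

text \<open>A copy is a subgraph isomorphic to the given graph; it need not be induced.\<close>

definition contains_copy :: "'a hypergraph \<Rightarrow> 'b hypergraph \<Rightarrow> bool" where
  "contains_copy G H \<longleftrightarrow>
     (\<exists>f. inj_on f (hverts H) \<and> f ` hverts H \<subseteq> hverts G \<and> (\<forall>e\<in>hedges H. f ` e \<in> hedges G))"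

text \<open>
  Up to isomorphism every finite graph has its vertices in the natural numbers.  The set below
  is always finite, and it is nonempty as soon as \<open>H\<close> has an edge (see the lemmas that follow);
  for an edgeless \<open>H\<close> it can be empty, and then the value carries no meaning.
\<close>

definition extremal_number :: "nat \<Rightarrow> 'b hypergraph \<Rightarrow> nat" where
  "extremal_number n H =
     Max {card (hedges G) |G :: nat hypergraph.
            finite_simple_graph G \<and> card (hverts G) = n \<and> \<not> contains_copy G H}"

definition part :: "nat \<Rightarrow> nat \<Rightarrow> (nat \<times> nat) set" where
  "part t i = {i} \<times> {..<t}"

definition complete_partite_hypergraph :: "nat \<Rightarrow> nat \<Rightarrow> (nat \<times> nat) hypergraph" where
  "complete_partite_hypergraph r t =
     (let V = (\<Union>i<r. part t i)
      in (V, {e. e \<subseteq> V \<and> card e = r \<and> (\<forall>i<r. \<exists>!v. v \<in> e \<inter> part t i)}))"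

definition hypergraph_subdivision :: "'a hypergraph \<Rightarrow> ('a + 'a set) hypergraph" where
  "hypergraph_subdivision F =
     (hverts F <+> hedges F,
      {{Inl v, Inr e} |v e. v \<in> hverts F \<and> e \<in> hedges F \<and> v \<in> e})"

lemma finite_extremal_set:
  "finite {card (hedges G) |G :: nat hypergraph.
             finite_simple_graph G \<and> card (hverts G) = n \<and> \<not> contains_copy G H}"
proof (rule finite_subset)
  show "{card (hedges G) |G :: nat hypergraph.
           finite_simple_graph G \<and> card (hverts G) = n \<and> \<not> contains_copy G H} \<subseteq> {..2 ^ n}"
  proof
    fix k
    assume "k \<in> {card (hedges G) |G :: nat hypergraph.
        finite_simple_graph G \<and> card (hverts G) = n \<and> \<not> contains_copy G H}"
    then obtain G :: "nat hypergraph"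
      where k: "k = card (hedges G)" and G: "finite_simple_graph G" "card (hverts G) = n"
      by auto
    from G(1) have V: "finite (hverts G)" and E: "hedges G \<subseteq> Pow (hverts G)"
      by (auto simp: finite_simple_graph_def)
    then have "card (hedges G) \<le> card (Pow (hverts G))"
      by (intro card_mono) auto
    then show "k \<in> {..2 ^ n}"
      using V G(2) k by (simp add: card_Pow)
  qed
qed simp

lemma extremal_set_nonempty:
  assumes "hedges H \<noteq> {}"
  shows "{card (hedges G) |G :: nat hypergraph.
            finite_simple_graph G \<and> card (hverts G) = n \<and> \<not> contains_copy G H} \<noteq> {}"
proof -
  have "finite_simple_graph ({..<n}, {})" "\<not> contains_copy ({..<n}, {}) H"
    using assms by (auto simp: finite_simple_graph_def contains_copy_def)
  then have "card (hedges ({..<n}, {} :: nat set set)) \<in> {card (hedges G) |G :: nat hypergraph.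
      finite_simple_graph G \<and> card (hverts G) = n \<and> \<not> contains_copy G H}"
    by (intro CollectI exI[of _ "({..<n}, {})"]) auto
  then show ?thesis by blast
qed

lemma hedges_subdivision_complete_partite:
  assumes "r > 0" "t > 0"
  shows "hedges (hypergraph_subdivision (complete_partite_hypergraph r t)) \<noteq> {}"
proof -
  let ?e = "(\<lambda>i. (i, 0)) ` {..<r} :: (nat \<times> nat) set"
  let ?K = "complete_partite_hypergraph r t"
  have "card ?e = r"
    by (subst card_image) (auto simp: inj_on_def)
  then have "?e \<in> hedges ?K"
    using assms by (auto simp: complete_partite_hypergraph_def part_def Let_def)
  moreover have "(0, 0) \<in> ?e"
    using assms by simp
  moreover have "(0, 0) \<in> hverts ?K"
    using assms by (simp add: complete_partite_hypergraph_def part_def Let_def)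
  ultimately have "{Inl (0, 0), Inr ?e} \<in> hedges (hypergraph_subdivision ?K)"
    unfolding hypergraph_subdivision_def snd_conv
    by (intro CollectI exI[of _ "(0, 0)"] exI[of _ ?e] conjI refl)
  then show ?thesis by blast
qed

end

theory Submission
  imports Defs
begin

text \<open>
  Call an \<open>r\<close>-tuple heavy if it has at least \<open>m\<close> common neighbours, where \<open>m\<close> is large enough that a
  copy of \<open>K\<^bsub>t,\<dots>,t\<^esub>\<close> all of whose edges are heavy extends greedily to a copy of its subdivision.
  By the Sidorenko-type count of such copies, in a graph without the subdivision at most half of
  the \<open>r\<close>-tuples in any large neighbourhood are heavy, so double counting over the light tuples
  gives that the sum of \<open>d(x)\<^sup>r\<close> is at most \<open>2 m n\<^sup>r\<close>.  Hence few vertices have degree above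
  \<open>n\<^bsup>1 - c\<^esup>\<close>, \<open>c = 1 / (4 r)\<close>, and the set \<open>X\<close> of the remaining ones carries most edges.  If there
  were more than \<open>C n\<^bsup>2 - 1/r - \<delta>\<^esup>\<close> edges, at least \<open>n\<^bsup>r - r \<delta>\<^esup>\<close> tuples would be light and have a common
  neighbour in \<open>X\<close>, so they would contain at least \<open>n\<^bsup>r t - c / 2\<^esup>\<close> copies of \<open>K\<^bsub>t,\<dots>,t\<^esub>\<close>.  Only
  \<open>O(n\<^bsup>r t - c\<^esup>)\<close> sequences of \<open>r t\<close> vertices repeat a vertex, contain an edge at a vertex of \<open>X\<close>, or
  have \<open>r + 1\<close> entries with a common neighbour in \<open>X\<close>.  In any other copy the common neighbours
  chosen in \<open>X\<close> are automatically distinct and outside the copy: again a subdivision.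
\<close>

section \<open>Power mean inequality\<close>

text \<open>Multiplying the bound for \<open>k\<close> by \<open>x\<close> gives the bound for
  \<open>Suc k\<close> plus \<open>k * a ^ (k - 1) * (x - a) ^ 2\<close>, which is
  nonnegative.\<close>

lemma power_ge_tangent:
  fixes a x :: real
  assumes "0 \<le> a" "0 \<le> x"
  shows "a ^ k + real k * a ^ (k - 1) * (x - a) \<le> x ^ k"
proof (induction k)
  case (Suc k)
  show ?case
  proof (cases k)
    case (Suc j)
    have "x * (a ^ k + real k * a ^ (k - 1) * (x - a)) \<le> x * x ^ k"
      using Suc.IH assms by (intro mult_left_mono)
    moreover have "0 \<le> real k * a ^ j * (x - a)\<^sup>2"
      using assms by simp
    ultimately show ?thesis
      by (simp add: Suc algebra_simps power2_eq_square)
  qed simp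
qed simp

text \<open>Summing the tangent bound at the mean \<open>a\<close> cancels the linear terms.\<close>

lemma power_mean_le:
  fixes f :: "'a \<Rightarrow> real"
  assumes "\<And>x. x \<in> S \<Longrightarrow> 0 \<le> f x"
  shows "real (card S) * (sum f S / real (card S)) ^ k \<le> (\<Sum>x\<in>S. f x ^ k)"
proof (cases "card S = 0")
  case True
  then show ?thesis by (simp add: assms sum_nonneg)
next
  case False
  define a where "a = sum f S / real (card S)"
  have "0 \<le> a"
    using assms by (simp add: a_def sum_nonneg)
  then have "(\<Sum>x\<in>S. a ^ k + real k * a ^ (k - 1) * (f x - a)) \<le> (\<Sum>x\<in>S. f x ^ k)"
    using assms by (intro sum_mono power_ge_tangent)
  moreover have "(\<Sum>x\<in>S. f x - a) = 0"
    using False by (simp add: sum_subtractf a_def)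
  ultimately show ?thesis
    by (simp add: sum.distrib flip: sum_distrib_left a_def)
qed

section \<open>Counting homomorphisms from complete partite hypergraphs\<close>

definition tuples :: "'a set \<Rightarrow> nat \<Rightarrow> 'a list set" where
  "tuples A n = {xs. set xs \<subseteq> A \<and> length xs = n}"

lemma finite_tuples: "finite A \<Longrightarrow> finite (tuples A n)"
  by (simp add: tuples_def finite_lists_length_eq)

lemma card_tuples: "finite A \<Longrightarrow> card (tuples A n) = card A ^ n"
  by (simp add: tuples_def card_lists_length_eq)

text \<open>Homomorphisms from the complete \<open>r\<close>-partite \<open>r\<close>-uniform hypergraph with parts of size \<open>t\<close>
  to the \<open>r\<close>-ary relation \<open>L\<close>, the image of each part being listed as a \<open>t\<close>-tuple.\<close>

definition partite_homs :: "'a set \<Rightarrow> nat \<Rightarrow> nat \<Rightarrow> 'a list set \<Rightarrow> 'a list list set" where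
  "partite_homs V t r L = {ys \<in> tuples (tuples V t) r. listset (map set ys) \<subseteq> L}"

lemma finite_partite_homs: "finite V \<Longrightarrow> finite (partite_homs V t r L)"
  by (simp add: partite_homs_def finite_tuples)

text \<open>Peels off the image \<open>y\<close> of the first part: the rest is a homomorphism into
  the common link of the entries of \<open>y\<close>, again an \<open>r\<close>-ary
  relation.\<close>

lemma partite_homs_Suc:
  "partite_homs V t (Suc r) L =
     (\<Union>y\<in>tuples V t. (#) y ` partite_homs V t r {zs \<in> tuples V r. \<forall>v\<in>set y. v # zs \<in> L})"
  (is "?A = ?B")
proof
  have *: "listset (map set ys) \<subseteq> tuples V r" if "ys \<in> tuples (tuples V t) r" for ys
    using that
    by (induction ys arbitrary: r) (fastforce simp: tuples_def set_Cons_def)+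
  show "?A \<subseteq> ?B"
  proof
    fix zs assume zs: "zs \<in> ?A"
    then obtain y ys where [simp]: "zs = y # ys"
      by (cases zs) (auto simp: partite_homs_def tuples_def)
    have "ys \<in> tuples (tuples V t) r" "y \<in> tuples V t" and L: "set_Cons (set y) (listset (map set ys)) \<subseteq> L"
      using zs by (simp_all add: partite_homs_def tuples_def)
    moreover have "listset (map set ys) \<subseteq> {zs \<in> tuples V r. \<forall>v\<in>set y. v # zs \<in> L}"
      using L *[OF calculation(1)] by (auto simp: set_Cons_def)
    ultimately show "zs \<in> ?B"
      by (auto simp: partite_homs_def)
  qed
  show "?B \<subseteq> ?A"
    by (force simp: partite_homs_def set_Cons_def tuples_def)
qed

text \<open>Sidorenko's inequality, for \<open>t ^ r\<close> edges and density
  \<open>card L / card V ^ r\<close>. The induction applies the bound to the common link of each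
  choice of the first part and averages by convexity.\<close>

lemma card_partite_homs_ge:
  assumes "finite V" "V \<noteq> {}" "L \<subseteq> tuples V r"
  shows "real (card V) ^ (r * t) * (real (card L) / real (card V) ^ r) ^ (t ^ r)
           \<le> real (card (partite_homs V t r L))"
  using assms(3)
proof (induction r arbitrary: L)
  case 0
  have "partite_homs V t 0 {[]} = {[]}"
    by (auto simp: partite_homs_def tuples_def)
  moreover have "L = {} \<or> L = {[]}"
    using 0 by (auto simp: tuples_def)
  ultimately show ?case
    by (elim disjE) simp_all
next
  case (Suc r)
  define n where "n = real (card V)"
  have n: "n > 0"
    using assms(1,2) by (simp add: n_def card_gt_0_iff)
  define Lk where "Lk y = {zs \<in> tuples V r. \<forall>v\<in>set y. v # zs \<in> L}" for y
  define D where "D zs = {v \<in> V. v # zs \<in> L}" for zs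
  have fin: "finite (tuples V k)" for k
    using assms(1) by (rule finite_tuples)
  have finL: "finite (Lk y)" for y
    using fin by (simp add: Lk_def)
  have finD: "finite (D zs)" for zs
    using assms(1) by (simp add: D_def)
  have "card L = card (SIGMA zs:tuples V r. D zs)"
  proof (rule bij_betw_same_card[symmetric])
    have "xs \<in> (\<lambda>(zs, v). v # zs) ` (SIGMA zs:tuples V r. D zs)" if "xs \<in> L" for xs
    proof -
      have "xs \<in> tuples V (Suc r)"
        using that Suc.prems by blast
      then obtain v zs where "xs = v # zs" "zs \<in> tuples V r" "v \<in> V"
        by (cases xs) (auto simp: tuples_def)
      with that show ?thesis
        by (force simp: D_def)
    qed
    then show "bij_betw (\<lambda>(zs, v). v # zs) (SIGMA zs:tuples V r. D zs) L"
      by (auto simp: bij_betw_def inj_on_def D_def)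
  qed
  then have L: "real (card L) = (\<Sum>zs\<in>tuples V r. real (card (D zs)))"
    using fin finD by (simp add: card_SigmaI)
  \<comment> \<open>Pairs \<open>(y, zs)\<close> with every entry of \<open>y\<close> extending
    \<open>zs\<close> are counted from both sides.\<close>
  have "(\<Sum>y\<in>tuples V t. card (Lk y)) = card (SIGMA y:tuples V t. Lk y)"
    using fin finL by (simp add: card_SigmaI)
  also have "\<dots> = card (SIGMA zs:tuples V r. tuples (D zs) t)"
    by (rule bij_betw_same_card[of prod.swap], rule bij_betw_byWitness[of _ prod.swap])
       (auto simp: Lk_def D_def tuples_def)
  also have "\<dots> = (\<Sum>zs\<in>tuples V r. card (D zs) ^ t)"
    using fin finD by (simp add: card_SigmaI finite_tuples card_tuples)
  finally have "(\<Sum>y\<in>tuples V t. real (card (Lk y))) = (\<Sum>zs\<in>tuples V r. real (card (D zs)) ^ t)"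
    by (simp flip: of_nat_sum of_nat_power)
  \<comment> \<open>First use of convexity, over \<open>zs\<close> with exponent \<open>t\<close>:
    the links are large on average.\<close>
  then have Lk: "n ^ r * (real (card L) / n ^ r) ^ t \<le> (\<Sum>y\<in>tuples V t. real (card (Lk y)))"
    using power_mean_le[of "tuples V r" "\<lambda>zs. real (card (D zs))" t] assms(1)
    by (simp add: L card_tuples n_def)
  have "n ^ (Suc r * t) * (real (card L) / n ^ Suc r) ^ (t ^ Suc r) =
      n ^ (r * t) * (n ^ t * ((real (card L) / n ^ Suc r) ^ t) ^ (t ^ r))"
    unfolding mult_Suc power_add power_Suc by (simp only: power_mult mult_ac)
  also have "\<dots> \<le> n ^ (r * t) * (n ^ t *
      ((\<Sum>y\<in>tuples V t. real (card (Lk y)) / n ^ r) / n ^ t) ^ (t ^ r))"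
  proof -
    have "(real (card L) / n ^ Suc r) ^ t = n ^ r * (real (card L) / n ^ r) ^ t / n ^ r / n ^ t"
      using n by (simp add: power_divide power_mult_distrib)
    also have "\<dots> \<le> (\<Sum>y\<in>tuples V t. real (card (Lk y))) / n ^ r / n ^ t"
      using Lk n by (intro divide_right_mono) auto
    finally show ?thesis
      using n by (intro mult_left_mono power_mono) (simp_all add: sum_divide_distrib)
  qed
  \<comment> \<open>Second use, over \<open>y\<close> with exponent \<open>t ^ r\<close>: the power
    moves inside the sum, where the induction hypothesis fits each link.\<close>
  also have "\<dots> \<le> n ^ (r * t) * (\<Sum>y\<in>tuples V t. (real (card (Lk y)) / n ^ r) ^ (t ^ r))"
    using power_mean_le[of "tuples V t" "\<lambda>y. real (card (Lk y)) / n ^ r" "t ^ r"] assms(1)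
    by (intro mult_left_mono) (auto simp: n_def card_tuples)
  also have "\<dots> \<le> (\<Sum>y\<in>tuples V t. real (card (partite_homs V t r (Lk y))))"
    unfolding sum_distrib_left n_def by (intro sum_mono Suc.IH) (auto simp: Lk_def)
  also have "\<dots> = real (\<Sum>y\<in>tuples V t. card ((#) y ` partite_homs V t r (Lk y)))"
    by (simp add: card_image)
  also have "\<dots> = real (card (partite_homs V t (Suc r) L))"
    unfolding partite_homs_Suc Lk_def[symmetric] using fin assms(1)
    by (subst card_UN_disjoint) (auto simp: finite_partite_homs)
  finally show ?case
    by (simp add: n_def)
qed

section \<open>Lists showing a forbidden pattern\<close>

text \<open>The positions are distinct but come in any order, so one count covers repeated vertices,
  edges and \<open>r + 1\<close> entries with a common neighbour.\<close>

definition lists_hitting :: "'a set \<Rightarrow> nat \<Rightarrow> nat \<Rightarrow> 'a list set \<Rightarrow> 'a list set" where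
  "lists_hitting V q k Q =
     {xs \<in> tuples V q. \<exists>js\<in>tuples {..<q} k. distinct js \<and> map ((!) xs) js \<in> Q}"

text \<open>A list is determined by its entries at \<open>js\<close>, with at most
  \<open>card Q\<close> choices, and at the \<open>q - k\<close> other positions.\<close>

lemma card_lists_with_entries_le:
  assumes "finite V" "finite Q" "js \<in> tuples {..<q} k" "distinct js"
  shows "card {xs \<in> tuples V q. map ((!) xs) js \<in> Q} \<le> card Q * card V ^ (q - k)"
proof -
  obtain ks where ks: "set ks = {..<q} - set js" "distinct ks"
    using finite_distinct_list[of "{..<q} - set js"] by auto
  have "length ks = card ({..<q} - set js)"
    using ks by (metis distinct_card)
  also have "\<dots> = q - k"
    using assms(3,4) by (subst card_Diff_subset) (auto simp: tuples_def distinct_card)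
  finally have len: "length ks = q - k" .
  have "card {xs \<in> tuples V q. map ((!) xs) js \<in> Q} \<le> card (Q \<times> tuples V (q - k))"
  proof (rule card_inj_on_le)
    show "inj_on (\<lambda>xs. (map ((!) xs) js, map ((!) xs) ks)) {xs \<in> tuples V q. map ((!) xs) js \<in> Q}"
    proof (rule inj_onI)
      fix xs xs'
      assume xs: "xs \<in> {xs \<in> tuples V q. map ((!) xs) js \<in> Q}"
        and xs': "xs' \<in> {xs \<in> tuples V q. map ((!) xs) js \<in> Q}"
        and eq: "(map ((!) xs) js, map ((!) xs) ks) = (map ((!) xs') js, map ((!) xs') ks)"
      have "xs ! i = xs' ! i" if "i < q" for i
        using that eq ks(1) by (cases "i \<in> set js") auto
      then show "xs = xs'"
        using xs xs' by (auto simp: tuples_def intro: nth_equalityI)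
    qed
    show "(\<lambda>xs. (map ((!) xs) js, map ((!) xs) ks)) ` {xs \<in> tuples V q. map ((!) xs) js \<in> Q}
        \<subseteq> Q \<times> tuples V (q - k)"
      using ks(1) len by (fastforce simp: tuples_def)
  qed (use assms in \<open>auto simp: finite_tuples\<close>)
  then show ?thesis
    using assms by (simp add: card_cartesian_product card_tuples)
qed

lemma card_lists_hitting_le:
  assumes "finite V" "finite Q"
  shows "card (lists_hitting V q k Q) \<le> q ^ k * card Q * card V ^ (q - k)"
proof -
  have "lists_hitting V q k Q =
      (\<Union>js\<in>{js \<in> tuples {..<q} k. distinct js}. {xs \<in> tuples V q. map ((!) xs) js \<in> Q})"
    by (auto simp: lists_hitting_def)
  also have "card \<dots> \<le>
      (\<Sum>js\<in>{js \<in> tuples {..<q} k. distinct js}. card {xs \<in> tuples V q. map ((!) xs) js \<in> Q})"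
    by (rule card_UN_le) (simp add: finite_tuples)
  also have "\<dots> \<le> card {js \<in> tuples {..<q} k. distinct js} * (card Q * card V ^ (q - k))"
    using assms by (intro sum_bounded_above[where 'a = nat, simplified] card_lists_with_entries_le) auto
  also have "\<dots> \<le> card (tuples {..<q} k) * (card Q * card V ^ (q - k))"
    by (intro mult_right_mono card_mono) (auto simp: finite_tuples)
  finally show ?thesis
    by (simp add: card_tuples mult_ac)
qed

text \<open>Different entries sit at different positions, so distinctness of \<open>zs\<close>
  yields distinct positions.\<close>

lemma lists_hittingI:
  assumes "xs \<in> tuples V q" "set zs \<subseteq> set xs" "distinct zs" "length zs = k" "zs \<in> Q"
  shows "xs \<in> lists_hitting V q k Q"
proof -
  have "\<forall>z\<in>set zs. \<exists>i<q. xs ! i = z"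
    using assms(1,2) by (metis (mono_tags, lifting) in_set_conv_nth mem_Collect_eq subsetD tuples_def)
  then obtain p where p: "\<forall>z\<in>set zs. p z < q \<and> xs ! p z = z"
    by metis
  then have "distinct (map p zs)"
    using assms(3) by (auto simp: distinct_map intro!: inj_onI) metis
  moreover have "map ((!) xs) (map p zs) = zs"
    using p by (simp add: map_idI)
  moreover have "map p zs \<in> tuples {..<q} k"
    using p assms(4) by (auto simp: tuples_def)
  ultimately show ?thesis
    using assms(1,5) unfolding lists_hitting_def
    by (intro CollectI conjI bexI[of _ "map p zs"]) simp_all
qed

text \<open>The pattern \<open>[v, v]\<close> is not distinct itself, so the two positions come
  directly from the repetition in \<open>xs\<close>.\<close>

lemma not_distinct_lists_hitting:
  assumes "xs \<in> tuples V q" "\<not> distinct xs"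
  shows "xs \<in> lists_hitting V q 2 ((\<lambda>v. [v, v]) ` V)"
proof -
  obtain i j where ij: "i < length xs" "j < length xs" "i \<noteq> j" "xs ! i = xs ! j"
    using assms(2) by (auto simp: distinct_conv_nth)
  then have "[i, j] \<in> tuples {..<q} 2" "distinct [i, j]"
    using assms(1) by (auto simp: tuples_def)
  moreover have "xs ! j \<in> V"
    using ij(2) assms(1) by (auto simp: tuples_def)
  then have "map ((!) xs) [i, j] \<in> (\<lambda>v. [v, v]) ` V"
    using ij(4) by simp
  ultimately show ?thesis
    using assms(1) unfolding lists_hitting_def by (intro CollectI conjI bexI[of _ "[i, j]"])
qed

lemma concat_in_tuples: "ys \<in> tuples (tuples V t) r \<Longrightarrow> concat ys \<in> tuples V (r * t)"
  by (induction ys arbitrary: r) (auto simp: tuples_def)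

text \<open>Blocks of equal length can be recovered from their concatenation, so
  \<open>concat\<close> is injective on homomorphisms; there are more than \<open>card B\<close> of
  them.\<close>

lemma exists_partite_hom_avoiding:
  assumes "finite V" "V \<noteq> {}" "L \<subseteq> tuples V r" "finite B"
    and "real (card B) < real (card V) ^ (r * t) * (real (card L) / real (card V) ^ r) ^ (t ^ r)"
  obtains ys where "ys \<in> partite_homs V t r L" "concat ys \<in> tuples V (r * t) - B"
proof -
  have tup: "concat ys \<in> tuples V (r * t)" if "ys \<in> partite_homs V t r L" for ys
    using that concat_in_tuples by (auto simp: partite_homs_def)
  have "inj_on concat (partite_homs V t r L)"
  proof (rule inj_onI)
    fix ys ys' assume "ys \<in> partite_homs V t r L" "ys' \<in> partite_homs V t r L" "concat ys = concat ys'"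
    then show "ys = ys'"
      by (intro concat_injective) (fastforce simp: partite_homs_def tuples_def dest: set_zip_leftD set_zip_rightD)+
  qed
  moreover have "\<not> card (partite_homs V t r L) \<le> card B"
    using card_partite_homs_ge[OF assms(1-3), of t] assms(5) by linarith
  ultimately have "\<not> concat ` partite_homs V t r L \<subseteq> B"
    using assms(4) by (metis card_inj_on_le)
  with tup that show ?thesis
    by blast
qed

lemma in_listset_iff: "zs \<in> listset As \<longleftrightarrow> list_all2 (\<in>) zs As"
  by (induction As arbitrary: zs) (auto simp: set_Cons_def list_all2_Cons2)

section \<open>Building a copy of the subdivision\<close>

text \<open>Greedy choice: when \<open>i\<close> is treated, fewer than \<open>card (W i)\<close>
  values are taken.\<close>

lemma exists_inj_choice:
  assumes "finite I" "\<And>i. i \<in> I \<Longrightarrow> card I \<le> card (W i)"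
  shows "\<exists>w. inj_on w I \<and> (\<forall>i\<in>I. w i \<in> W i)"
  using assms
proof (induction I)
  case (insert i I)
  then obtain w where w: "inj_on w I" "\<forall>i\<in>I. w i \<in> W i"
    by (metis card_insert_le insertCI order_trans)
  have "card (w ` I) < card (W i)"
    using insert.hyps insert.prems[of i] card_image_le[of I w] by simp
  then obtain a where a: "a \<in> W i" "a \<notin> w ` I"
    using insert.hyps(1) by (metis card_mono finite_imageI linorder_not_le subsetI)
  then have "inj_on (w(i := a)) (insert i I)"
    using w insert.hyps by (auto simp: inj_on_def)
  moreover have "\<forall>k\<in>insert i I. (w(i := a)) k \<in> W k"
    using w a by auto
  ultimately show ?case
    by blast
qed simp

definition neighbours :: "'a hypergraph \<Rightarrow> 'a \<Rightarrow> 'a set" where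
  "neighbours G x = {y \<in> hverts G. {x, y} \<in> hedges G}"

text \<open>\<open>\<phi>\<close> places the vertices and \<open>w\<close> the edges of
  \<open>F\<close>; their images are disjoint, so \<open>case_sum \<phi> w\<close> is
  injective.\<close>

lemma contains_copy_subdivisionI:
  assumes "inj_on \<phi> (hverts F)" "\<phi> ` hverts F \<subseteq> hverts G"
    and "inj_on w (hedges F)" "w ` hedges F \<subseteq> hverts G - \<phi> ` hverts F"
    and "\<And>e. e \<in> hedges F \<Longrightarrow> \<phi> ` e \<subseteq> neighbours G (w e)"
  shows "contains_copy G (hypergraph_subdivision F)"
  unfolding contains_copy_def
proof (intro exI[of _ "case_sum \<phi> w"] conjI ballI)
  have disj: "\<phi> v \<noteq> w e" if "v \<in> hverts F" "e \<in> hedges F" for v e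
    using that assms(4) by (metis DiffD2 image_eqI subsetD)
  have verts: "hverts (hypergraph_subdivision F) = hverts F <+> hedges F"
    by (simp add: hypergraph_subdivision_def)
  show "inj_on (case_sum \<phi> w) (hverts (hypergraph_subdivision F))"
  proof (rule inj_onI)
    fix a b
    assume "a \<in> hverts (hypergraph_subdivision F)" "b \<in> hverts (hypergraph_subdivision F)"
      "case_sum \<phi> w a = case_sum \<phi> w b"
    then show "a = b"
      using disj inj_onD[OF assms(1)] inj_onD[OF assms(3)] unfolding verts
      by (elim PlusE) (simp_all, metis)
  qed
  show "case_sum \<phi> w ` hverts (hypergraph_subdivision F) \<subseteq> hverts G"
    unfolding verts
  proof (rule image_subsetI)
    fix a assume "a \<in> hverts F <+> hedges F"
    then show "case_sum \<phi> w a \<in> hverts G"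
    proof (elim PlusE)
      fix v assume "v \<in> hverts F" "a = Inl v"
      then show ?thesis
        using assms(2) by (simp add: image_subset_iff)
    next
      fix e assume "e \<in> hedges F" "a = Inr e"
      then show ?thesis
        using assms(4) by (simp add: image_subset_iff)
    qed
  qed
  fix E assume "E \<in> hedges (hypergraph_subdivision F)"
  then obtain v e where E: "E = {Inl v, Inr e}" "e \<in> hedges F" "v \<in> e"
    by (auto simp: hypergraph_subdivision_def)
  then have "\<phi> v \<in> neighbours G (w e)"
    using assms(5)[of e] by (simp add: image_subset_iff)
  then show "case_sum \<phi> w ` E \<in> hedges G"
    by (simp add: E neighbours_def insert_commute)
qed

lemma hverts_complete_partite: "hverts (complete_partite_hypergraph r t) = {..<r} \<times> {..<t}"
  by (auto simp: complete_partite_hypergraph_def part_def Let_def)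

lemma hedges_complete_partiteD:
  assumes "e \<in> hedges (complete_partite_hypergraph r t)"
  shows "e \<subseteq> {..<r} \<times> {..<t}" "card e = r" "\<And>i. i < r \<Longrightarrow> \<exists>!j. (i, j) \<in> e"
proof -
  show e: "e \<subseteq> {..<r} \<times> {..<t}" "card e = r"
    using assms by (auto simp: complete_partite_hypergraph_def part_def Let_def)
  fix i assume "i < r"
  then have "\<exists>!v. v \<in> e \<inter> part t i"
    using assms by (auto simp: complete_partite_hypergraph_def Let_def)
  then show "\<exists>!j. (i, j) \<in> e"
    using e by (auto simp: part_def)
qed

lemma finite_hedges_complete_partite: "finite (hedges (complete_partite_hypergraph r t))"
  by (rule finite_subset[of _ "Pow ({..<r} \<times> {..<t})"]) (use hedges_complete_partiteD(1) in blast, simp)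

lemma inj_on_nth_nth:
  assumes "length ys = r" "\<And>y. y \<in> set ys \<Longrightarrow> length y = t" "distinct (concat ys)"
  shows "inj_on (\<lambda>(i, j). ys ! i ! j) ({..<r} \<times> {..<t})"
  using assms
proof (induction ys arbitrary: r)
  case (Cons y ys)
  then obtain s where s: "r = Suc s" "length ys = s"
    by auto
  have "i = i' \<and> j = j'"
    if "i < r" "i' < r" "j < t" "j' < t" "(y # ys) ! i ! j = (y # ys) ! i' ! j'" for i i' j j'
  proof -
    have mem: "ys ! k ! j \<in> set (concat ys)" if "k < s" "j < t" for k j
      using that s(2) Cons.prems(2) by (auto intro!: bexI[of _ "ys ! k"])
    have disj: "set y \<inter> set (concat ys) = {}" and len: "length y = t"
      using Cons.prems by simp_all
    have *: "y ! j \<noteq> ys ! k ! j'" if "k < s" "j < t" "j' < t" for k j j'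
      using mem[OF that(1,3)] disj nth_mem[of j y] len that(2) by (metis disjoint_iff)
    have "inj_on (\<lambda>(i, j). ys ! i ! j) ({..<s} \<times> {..<t})"
      using Cons s by auto
    then show ?thesis
      using that s *[of _ j j'] *[of _ j' j] Cons.prems
      by (cases i; cases i') (force simp: nth_eq_iff_index_eq inj_on_def)+
  qed
  then show ?case
    by (auto intro!: inj_onI)
qed simp

section \<open>Graphs without the subdivision\<close>

locale subdivision_free_graph =
  fixes G :: "'a hypergraph" and r t :: nat
  assumes simple: "finite_simple_graph G"
    and r: "2 \<le> r" and t: "2 \<le> t"
    and no_copy: "\<not> contains_copy G (hypergraph_subdivision (complete_partite_hypergraph r t))"
begin

abbreviation "V \<equiv> hverts G"
abbreviation "N \<equiv> neighbours G"
abbreviation "K \<equiv> complete_partite_hypergraph r t"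

text \<open>Removing the \<open>r * t\<close> vertices of a copy of \<open>K\<close> from
  \<open>m\<close> common neighbours leaves \<open>card (hedges K)\<close> candidates, as the greedy
  choice demands.\<close>

definition m :: nat where "m = card (hedges K) + r * t"

definition common :: "'a list \<Rightarrow> 'a set" where "common zs = {x \<in> V. set zs \<subseteq> N x}"

text \<open>Common neighbours are counted in all of \<open>V\<close>, while the one required to
  exist must lie in \<open>S\<close>.\<close>

definition light :: "'a set \<Rightarrow> 'a list set" where
  "light S = {zs \<in> tuples V r. card (common zs) < m \<and> (\<exists>x\<in>S. set zs \<subseteq> N x)}"

lemma finite_V: "finite V"
  using simple by (simp add: finite_simple_graph_def)

lemma N_subset: "N x \<subseteq> V"
  by (auto simp: neighbours_def)

lemma finite_N: "finite (N x)"
  using finite_V N_subset by (rule finite_subset[rotated])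

lemma not_self_neighbour: "x \<notin> N x"
  using simple by (auto simp: finite_simple_graph_def neighbours_def)

context
  fixes ys
  assumes ys: "ys \<in> tuples (tuples V t) r" and dist: "distinct (concat ys)"
begin

definition \<phi> where "\<phi> = (\<lambda>(i, j). ys ! i ! j)"

lemma inj_phi: "inj_on \<phi> (hverts K)"
  unfolding \<phi>_def hverts_complete_partite using ys dist
  by (intro inj_on_nth_nth) (auto simp: tuples_def)

lemma phi_image: "\<phi> ` hverts K \<subseteq> set (concat ys)"
proof
  fix v assume "v \<in> \<phi> ` hverts K"
  then obtain i j where ij: "v = ys ! i ! j" "i < r" "j < t"
    by (auto simp: \<phi>_def hverts_complete_partite)
  then have "ys ! i \<in> set ys"
    using ys by (simp add: tuples_def)
  moreover from this have "ys ! i \<in> tuples V t"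
    using ys by (auto simp: tuples_def)
  ultimately show "v \<in> set (concat ys)"
    using ij by (auto simp: tuples_def intro!: bexI[of _ "ys ! i"])
qed

lemma concat_subset: "set (concat ys) \<subseteq> V"
  using concat_in_tuples[OF ys] by (simp add: tuples_def)

text \<open>An edge of \<open>K\<close> has one vertex in each part, so it is the graph of a
  function \<open>g\<close>; reading \<open>ys ! i ! g i\<close> in order of \<open>i\<close> gives
  \<open>zs\<close>.\<close>

lemma transversal:
  assumes "e \<in> hedges K"
  shows "\<exists>zs\<in>listset (map set ys). set zs = \<phi> ` e"
proof -
  note e = hedges_complete_partiteD[OF assms]
  obtain g where g: "\<And>i. i < r \<Longrightarrow> (i, g i) \<in> e"
    using e(3) by metis
  have e_eq: "e = (\<lambda>i. (i, g i)) ` {..<r}"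
  proof -
    have "i < r \<and> j = g i" if "(i, j) \<in> e" for i j
      using that e(1) e(3)[of i] g[of i] by auto
    then show ?thesis
      using g by auto
  qed
  have "g i < t" if "i < r" for i
    using g[OF that] e(1) by auto
  then have "map (\<lambda>i. ys ! i ! g i) [0..<r] \<in> listset (map set ys)"
    using ys by (auto simp: in_listset_iff list_all2_conv_all_nth tuples_def subset_iff)
  moreover have "set (map (\<lambda>i. ys ! i ! g i) [0..<r]) = \<phi> ` e"
    by (auto simp: e_eq \<phi>_def image_iff)
  ultimately show ?thesis
    by blast
qed

text \<open>Every edge of \<open>K\<close> maps to a tuple with at least \<open>m\<close> common
  neighbours, so distinct ones outside the copy are chosen greedily.\<close>

lemma no_heavy_hom:
  assumes "listset (map set ys) \<subseteq> {zs. m \<le> card (common zs)}"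
  shows False
proof -
  define W where "W e = {x \<in> V. \<phi> ` e \<subseteq> N x} - set (concat ys)" for e
  have "length (concat ys) = r * t"
    using concat_in_tuples[OF ys] by (simp add: tuples_def)
  have "card (hedges K) \<le> card (W e)" if e: "e \<in> hedges K" for e
  proof -
    obtain zs where "zs \<in> listset (map set ys)" "set zs = \<phi> ` e"
      using transversal[OF e] by blast
    then have "m \<le> card {x \<in> V. \<phi> ` e \<subseteq> N x}"
      using assms by (auto simp: common_def)
    moreover have "card (set (concat ys)) \<le> r * t"
      using \<open>length (concat ys) = r * t\<close> by (metis card_length)
    ultimately show ?thesis
      using diff_card_le_card_Diff[of "set (concat ys)" "{x \<in> V. \<phi> ` e \<subseteq> N x}"]
      by (simp add: m_def W_def)
  qed
  then obtain w where w: "inj_on w (hedges K)" "\<forall>e\<in>hedges K. w e \<in> W e"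
    using exists_inj_choice[OF finite_hedges_complete_partite] by blast
  have W: "w e \<in> V" "w e \<notin> set (concat ys)" "\<phi> ` e \<subseteq> N (w e)" if "e \<in> hedges K" for e
    using bspec[OF w(2) that] by (simp_all add: W_def)
  have "contains_copy G (hypergraph_subdivision K)"
  proof (rule contains_copy_subdivisionI[OF inj_phi _ w(1)])
    show "\<phi> ` hverts K \<subseteq> V"
      using phi_image concat_subset by (rule order_trans)
    show "w ` hedges K \<subseteq> V - \<phi> ` hverts K"
    proof (rule image_subsetI)
      fix e assume "e \<in> hedges K"
      then show "w e \<in> V - \<phi> ` hverts K"
        using W(1,2) phi_image by (meson DiffI subsetD)
    qed
  qed (rule W(3))
  then show False
    using no_copy by blast
qed

text \<open>By the last assumption \<open>w e\<close> has no neighbour in the copy beyond the image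
  of \<open>e\<close>. Hence \<open>w e\<close> determines \<open>e\<close>, and being adjacent to
  the copy it lies outside it.\<close>

lemma no_sparse_hom:
  assumes "listset (map set ys) \<subseteq> light X" "X \<subseteq> V"
    and "\<And>x. x \<in> X \<Longrightarrow> x \<in> set (concat ys) \<Longrightarrow> N x \<inter> set (concat ys) = {}"
    and "\<And>x. x \<in> X \<Longrightarrow> card (N x \<inter> set (concat ys)) \<le> r"
  shows False
proof -
  have "\<exists>x\<in>X. \<phi> ` e \<subseteq> N x" if "e \<in> hedges K" for e
    using transversal[OF that] assms(1) by (fastforce simp: light_def)
  then obtain w where w: "\<And>e. e \<in> hedges K \<Longrightarrow> w e \<in> X \<and> \<phi> ` e \<subseteq> N (w e)"
    by metis
  have sub: "\<phi> ` e \<subseteq> N (w e) \<inter> set (concat ys)" if "e \<in> hedges K" for e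
    using w[OF that] phi_image hedges_complete_partiteD(1)[OF that]
    by (force simp: hverts_complete_partite)
  have im: "\<phi> ` e = N (w e) \<inter> set (concat ys)" if e: "e \<in> hedges K" for e
  proof -
    have "inj_on \<phi> e"
      using inj_phi hedges_complete_partiteD(1)[OF e]
      by (auto simp: hverts_complete_partite intro: inj_on_subset)
    then have "card (\<phi> ` e) = r"
      using hedges_complete_partiteD(2)[OF e] by (simp add: card_image)
    then show ?thesis
      using sub[OF e] assms(4) w[OF e] by (intro card_seteq) auto
  qed
  have inj_w: "inj_on w (hedges K)"
  proof (rule inj_onI)
    fix e e' assume e: "e \<in> hedges K" "e' \<in> hedges K" "w e = w e'"
    then have "\<phi> ` e = \<phi> ` e'"
      using im by metis
    then show "e = e'"
      using inj_phi e hedges_complete_partiteD(1) inj_on_image_eq_iff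
      by (metis hverts_complete_partite)
  qed
  have notin: "w e \<notin> set (concat ys)" if e: "e \<in> hedges K" for e
  proof
    assume "w e \<in> set (concat ys)"
    then have "\<phi> ` e = {}"
      using assms(3)[of "w e"] w[OF e] im[OF e] by simp
    then show False
      using hedges_complete_partiteD(2)[OF e] r by simp
  qed
  have "contains_copy G (hypergraph_subdivision K)"
  proof (rule contains_copy_subdivisionI[OF inj_phi _ inj_w])
    show "\<phi> ` hverts K \<subseteq> V"
      using phi_image concat_subset by (rule order_trans)
    show "w ` hedges K \<subseteq> V - \<phi> ` hverts K"
    proof (rule image_subsetI)
      fix e assume e: "e \<in> hedges K"
      show "w e \<in> V - \<phi> ` hverts K"
        using w[OF e] assms(2) notin[OF e] phi_image by (meson DiffI subsetD)
    qed
  qed (use w in blast)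
  then show False
    using no_copy by blast
qed

end

section \<open>Light tuples and powers of degrees\<close>

text \<open>Otherwise the heavy tuples have density above 1/2 in \<open>N x\<close>, and the
  homomorphisms into them outnumber the sequences with a repetition; one without repetition is
  excluded by \<open>no_heavy_hom\<close>.\<close>

lemma card_heavy_le:
  assumes "(r * t)\<^sup>2 * 2 ^ (t ^ r) < card (N x)"
  shows "2 * card {zs \<in> tuples (N x) r. m \<le> card (common zs)} \<le> card (N x) ^ r"
proof (rule ccontr)
  define d where "d = card (N x)"
  define L where "L = {zs \<in> tuples (N x) r. m \<le> card (common zs)}"
  define B where "B = lists_hitting (N x) (r * t) 2 ((\<lambda>v. [v, v]) ` N x)"
  assume "\<not> ?thesis"
  then have "d ^ r < 2 * card L"
    by (simp add: d_def L_def)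
  then have "real (d ^ r) < real (2 * card L)"
    by (simp only: of_nat_less_iff)
  then have L: "1 / 2 < real (card L) / real d ^ r"
    using assms by (simp add: d_def field_simps)
  have d: "0 < d" "N x \<noteq> {}"
    using assms by (auto simp: d_def)
  \<comment> \<open>As \<open>r * t\<close> is at least 2, the truncated subtractions are
    exact.\<close>
  have "2 * 2 \<le> r * t"
    using r t by (rule mult_le_mono)
  then obtain q where q: "r * t = Suc (Suc q)"
    by (metis One_nat_def Suc_le_D numeral_2_eq_2 mult_2 add_2_eq_Suc Suc_le_mono)
  have "card B \<le> (r * t)\<^sup>2 * card ((\<lambda>v. [v, v]) ` N x) * d ^ (r * t - 2)"
    unfolding B_def d_def by (intro card_lists_hitting_le finite_imageI finite_N)
  also have "\<dots> \<le> (r * t)\<^sup>2 * d * d ^ (r * t - 2)"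
    unfolding d_def by (intro mult_right_mono mult_left_mono card_image_le finite_N) auto
  also have "\<dots> = (r * t)\<^sup>2 * d ^ (r * t - 1)"
    by (simp add: q)
  finally have "real (card B) \<le> real ((r * t)\<^sup>2 * d ^ (r * t - 1))"
    by (simp only: of_nat_le_iff)
  \<comment> \<open>Isolates the factor that is smaller than \<open>d\<close> by assumption, so that
    one power of \<open>d\<close> is gained.\<close>
  also have "\<dots> = real ((r * t)\<^sup>2 * 2 ^ (t ^ r)) * (real d ^ (r * t - 1) * (1 / 2) ^ (t ^ r))"
    by (simp add: power_one_over)
  also have "\<dots> < real d * (real d ^ (r * t - 1) * (1 / 2) ^ (t ^ r))"
    using d assms by (intro mult_strict_right_mono) (auto simp: d_def simp del: of_nat_mult of_nat_power)
  also have "\<dots> = real d ^ (r * t) * (1 / 2) ^ (t ^ r)"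
    by (simp add: q)
  also have "\<dots> \<le> real d ^ (r * t) * (real (card L) / real d ^ r) ^ (t ^ r)"
    using L by (intro mult_left_mono power_mono) auto
  finally have *: "real (card B) < real d ^ (r * t) * (real (card L) / real d ^ r) ^ (t ^ r)" .
  have "finite B"
    using finite_N by (simp add: B_def lists_hitting_def finite_tuples)
  then obtain ys where ys: "ys \<in> partite_homs (N x) t r L" "concat ys \<in> tuples (N x) (r * t) - B"
    using exists_partite_hom_avoiding[OF finite_N d(2) _ _ *[unfolded d_def]] by (auto simp: L_def)
  have "distinct (concat ys)"
    using ys(2) not_distinct_lists_hitting unfolding B_def by blast
  moreover have "ys \<in> tuples (tuples V t) r"
    using ys(1) N_subset by (fastforce simp: partite_homs_def tuples_def)
  ultimately show False
    using no_heavy_hom ys(1) by (fastforce simp: partite_homs_def L_def)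
qed

text \<open>Double counting of pairs of \<open>x\<close> in \<open>S\<close> and a light tuple in
  \<open>N x\<close>: at least half of the tuples in \<open>N x\<close> are light, and a light tuple
  lies in fewer than \<open>m\<close> neighbourhoods.\<close>

lemma sum_degree_power_le:
  assumes "S \<subseteq> V" "\<And>x. x \<in> S \<Longrightarrow> (r * t)\<^sup>2 * 2 ^ (t ^ r) < card (N x)"
  shows "(\<Sum>x\<in>S. card (N x) ^ r) \<le> 2 * m * card (light S)"
proof -
  have finS: "finite S"
    using assms(1) finite_V by (rule finite_subset)
  have finL: "finite (light S)"
    using finite_V by (simp add: light_def finite_tuples)
  define A where "A x = {zs \<in> tuples (N x) r. card (common zs) < m}" for x
  have finA: "finite (A x)" for x
    by (simp add: A_def finite_tuples finite_N)
  have "card (N x) ^ r \<le> 2 * card (A x)" if "x \<in> S" for x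
  proof -
    have "tuples (N x) r = A x \<union> {zs \<in> tuples (N x) r. m \<le> card (common zs)}"
      by (auto simp: A_def)
    then have "card (tuples (N x) r) \<le> card (A x) + card {zs \<in> tuples (N x) r. m \<le> card (common zs)}"
      by (metis card_Un_le)
    then show ?thesis
      using card_heavy_le[OF assms(2)[OF that]] by (simp add: card_tuples finite_N)
  qed
  then have "(\<Sum>x\<in>S. card (N x) ^ r) \<le> (\<Sum>x\<in>S. 2 * card (A x))"
    by (rule sum_mono)
  also have "\<dots> = 2 * card (SIGMA x:S. A x)"
    using finS finA by (simp add: card_SigmaI sum_distrib_left)
  also have "card (SIGMA x:S. A x) \<le> card (SIGMA zs:light S. common zs)"
  proof (rule card_inj_on_le)
    show "prod.swap ` (SIGMA x:S. A x) \<subseteq> (SIGMA zs:light S. common zs)"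
      using assms(1) N_subset by (fastforce simp: A_def light_def common_def tuples_def)
    show "finite (SIGMA zs:light S. common zs)"
      using finL finite_V by (auto simp: common_def intro!: finite_SigmaI)
  qed simp
  also have "\<dots> = (\<Sum>zs\<in>light S. card (common zs))"
    using finL finite_V by (simp add: card_SigmaI common_def)
  also have "\<dots> \<le> (\<Sum>zs\<in>light S. m)"
    by (intro sum_mono) (auto simp: light_def)
  finally show ?thesis
    by (simp add: mult_ac)
qed

lemma card_hedges_le: "card (hedges G) \<le> (\<Sum>x\<in>V. card (N x))"
proof -
  have "hedges G \<subseteq> (\<lambda>(x, y). {x, y}) ` (SIGMA x:V. N x)"
  proof
    fix e assume e: "e \<in> hedges G"
    then have "card e = 2" "e \<subseteq> V"
      using simple by (auto simp: finite_simple_graph_def)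
    then obtain x y where "e = {x, y}"
      by (auto simp: card_2_iff)
    with e \<open>e \<subseteq> V\<close> show "e \<in> (\<lambda>(x, y). {x, y}) ` (SIGMA x:V. N x)"
      by (auto simp: neighbours_def image_iff)
  qed
  then have "card (hedges G) \<le> card (SIGMA x:V. N x)"
    using finite_V finite_N by (intro surj_card_le finite_SigmaI)
  then show ?thesis
    using finite_V finite_N by (simp add: card_SigmaI)
qed

section \<open>Copies spanned by light tuples\<close>

text \<open>The left side is a lower bound for the homomorphisms into \<open>light X\<close>, the
  right side an upper bound for the bad sequences. If the left were larger, a homomorphism would
  avoid all of these, against \<open>no_sparse_hom\<close>.\<close>

lemma card_light_sparse:
  assumes "V \<noteq> {}" "X \<subseteq> V"
  shows "real (card V) ^ (r * t) * (real (card (light X)) / real (card V) ^ r) ^ (t ^ r)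
    \<le> real ((r * t)\<^sup>2 * card V * card V ^ (r * t - 2)
        + (r * t)\<^sup>2 * (\<Sum>x\<in>X. card (N x)) * card V ^ (r * t - 2)
        + (r * t) ^ Suc r * (\<Sum>x\<in>X. card (N x) ^ Suc r) * card V ^ (r * t - Suc r))"
proof (rule ccontr)
  assume less: "\<not> ?thesis"
  have finX: "finite X"
    using assms(2) finite_V by (rule finite_subset)
  \<comment> \<open>Patterns for a repeated vertex, an edge at a vertex of \<open>X\<close>, and
    \<open>r + 1\<close> entries with a common neighbour in \<open>X\<close>; they give the three
    summands in this order.\<close>
  define Q1 where "Q1 = (\<lambda>v. [v, v]) ` V"
  define Q2 where "Q2 = (\<lambda>(x, y). [x, y]) ` (SIGMA x:X. N x)"
  define Q3 where "Q3 = (\<Union>x\<in>X. tuples (N x) (Suc r))"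
  define B where "B = lists_hitting V (r * t) 2 Q1 \<union> lists_hitting V (r * t) 2 Q2
    \<union> lists_hitting V (r * t) (Suc r) Q3"
  have fin: "finite Q1" "finite Q2" "finite Q3"
    using finite_V finX finite_N by (auto simp: Q1_def Q2_def Q3_def finite_tuples intro!: finite_SigmaI)
  have Q1: "card Q1 \<le> card V"
    unfolding Q1_def using finite_V by (rule card_image_le)
  have Q2: "card Q2 \<le> (\<Sum>x\<in>X. card (N x))"
    unfolding Q2_def using finX finite_N
    by (intro order_trans[OF card_image_le]) (auto simp: card_SigmaI intro!: finite_SigmaI)
  have Q3: "card Q3 \<le> (\<Sum>x\<in>X. card (N x) ^ Suc r)"
    unfolding Q3_def using card_UN_le[OF finX, of "\<lambda>x. tuples (N x) (Suc r)"]
    by (simp only: card_tuples finite_N)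
  have "card B \<le> card (lists_hitting V (r * t) 2 Q1) + card (lists_hitting V (r * t) 2 Q2)
      + card (lists_hitting V (r * t) (Suc r) Q3)"
    unfolding B_def by (meson add_right_mono card_Un_le order_trans)
  also have "\<dots> \<le> (r * t)\<^sup>2 * card Q1 * card V ^ (r * t - 2) + (r * t)\<^sup>2 * card Q2 * card V ^ (r * t - 2)
      + (r * t) ^ Suc r * card Q3 * card V ^ (r * t - Suc r)"
    using fin finite_V by (intro add_mono card_lists_hitting_le)
  also have "\<dots> \<le> (r * t)\<^sup>2 * card V * card V ^ (r * t - 2)
        + (r * t)\<^sup>2 * (\<Sum>x\<in>X. card (N x)) * card V ^ (r * t - 2)
        + (r * t) ^ Suc r * (\<Sum>x\<in>X. card (N x) ^ Suc r) * card V ^ (r * t - Suc r)"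
    using Q1 Q2 Q3 by (intro add_mono mult_right_mono mult_left_mono) auto
  finally have *: "real (card B) < real (card V) ^ (r * t) * (real (card (light X)) / real (card V) ^ r) ^ (t ^ r)"
    using less by (meson le_less_trans not_le of_nat_mono)
  have "finite B" "light X \<subseteq> tuples V r"
    using finite_V by (auto simp: B_def lists_hitting_def light_def finite_tuples)
  then obtain ys where ys: "ys \<in> partite_homs V t r (light X)" "concat ys \<in> tuples V (r * t) - B"
    using exists_partite_hom_avoiding[OF finite_V assms(1) _ _ *] by blast
  then have tup: "concat ys \<in> tuples V (r * t)"
    and B: "concat ys \<notin> lists_hitting V (r * t) 2 Q1" "concat ys \<notin> lists_hitting V (r * t) 2 Q2"
      "concat ys \<notin> lists_hitting V (r * t) (Suc r) Q3"
    by (auto simp: B_def)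
  show False
  proof (rule no_sparse_hom)
    show "ys \<in> tuples (tuples V t) r" "listset (map set ys) \<subseteq> light X"
      using ys(1) by (auto simp: partite_homs_def)
    show "distinct (concat ys)"
      using tup B(1) not_distinct_lists_hitting unfolding Q1_def by blast
    show "N x \<inter> set (concat ys) = {}" if "x \<in> X" "x \<in> set (concat ys)" for x
    proof (rule ccontr)
      assume "N x \<inter> set (concat ys) \<noteq> {}"
      then obtain y where y: "y \<in> N x" "y \<in> set (concat ys)"
        by blast
      have "concat ys \<in> lists_hitting V (r * t) 2 Q2"
      proof (rule lists_hittingI[OF tup])
        show "set [x, y] \<subseteq> set (concat ys)"
          using y that by simp
        show "distinct [x, y]"
          using y(1) not_self_neighbour[of x] by auto
        show "[x, y] \<in> Q2"
          using y that unfolding Q2_def by force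
      qed simp
      with B show False by blast
    qed
    show "card (N x \<inter> set (concat ys)) \<le> r" if "x \<in> X" for x
    proof (rule ccontr)
      assume "\<not> card (N x \<inter> set (concat ys)) \<le> r"
      then have "Suc r \<le> card (N x \<inter> set (concat ys))"
        by simp
      then obtain T where T: "T \<subseteq> N x \<inter> set (concat ys)" "card T = Suc r" "finite T"
        by (rule obtain_subset_with_card_n)
      obtain zs where zs: "set zs = T" "distinct zs"
        using finite_distinct_list[OF T(3)] by blast
      then have "length zs = Suc r"
        using T(2) by (metis distinct_card)
      then have "zs \<in> Q3"
        using zs T that by (auto simp: Q3_def tuples_def)
      then have "concat ys \<in> lists_hitting V (r * t) (Suc r) Q3"
        using lists_hittingI[OF tup] zs T \<open>length zs = Suc r\<close> by blast
      with B show False by blast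
    qed
  qed (use assms in auto)
qed

end

section \<open>Constants and the final estimate\<close>

context subdivision_free_graph
begin

text \<open>With \<open>c = 1 / (4 * r)\<close> this solves
  \<open>t ^ r * (r * \<delta>) = c / 2\<close>: a density of at least
  \<open>n powr (- (r * \<delta>))\<close> costs the homomorphism count only half of the exponent
  \<open>c\<close> saved on the bad sequences.\<close>

definition \<delta> :: real where "\<delta> = 1 / (8 * real r ^ 2 * real (t ^ r))"

text \<open>Total coefficient of \<open>n powr (r * t - c)\<close> in the estimate of the three
  kinds of bad sequences.\<close>

definition B :: real where
  "B = 2 * real ((r * t)\<^sup>2) + 2 * real m * real ((r * t) ^ Suc r)"

text \<open>The first two terms absorb the vertices of small and of large degree and leave
  \<open>2 * m\<close> for those in between. The last forces \<open>B < n powr (c / 2)\<close>, as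
  there are at most \<open>n ^ 2\<close> edges and \<open>16 * r * (c / 2) = 2\<close>.\<close>

definition C :: real where
  "C = real ((r * t)\<^sup>2 * 2 ^ (t ^ r)) + 4 * real m + B powr (16 * real r)"

lemma m_pos: "0 < m"
  using r t by (simp add: m_def)

lemma B_pos: "0 < B"
  using r t by (simp add: B_def add_pos_nonneg)

lemma C_pos: "0 < C"
  using m_pos by (simp add: C_def add_pos_nonneg add_nonneg_pos)

lemma delta_pos: "0 < \<delta>"
  using r t by (simp add: \<delta>_def)

text \<open>The vertices of large degree are few by Markov's inequality, applied to the sum of the
  \<open>r\<close>-th powers of the degrees.\<close>

lemma sum_middle_degrees_ge:
  fixes n :: real
  defines "n \<equiv> real (card V)"
  defines "X \<equiv> {x \<in> V. (r * t)\<^sup>2 * 2 ^ (t ^ r) < card (N x) \<and> real (card (N x)) \<le> n powr (1 - 1 / (4 * real r))}"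
  assumes "V \<noteq> {}"
  shows "real (card (hedges G)) \<le>
    (\<Sum>x\<in>X. real (card (N x))) + (real ((r * t)\<^sup>2 * 2 ^ (t ^ r)) + 2 * real m) * n powr (5 / 4)"
proof -
  define D where "D = (r * t)\<^sup>2 * 2 ^ (t ^ r)"
  define d where "d x = real (card (N x))" for x
  define S where "S = {x \<in> V. card (N x) \<le> D}"
  define Y where "Y = {x \<in> V. D < card (N x) \<and> n powr (1 - 1 / (4 * real r)) < d x}"
  have n: "1 \<le> n"
    using assms(3) finite_V by (simp add: n_def Suc_le_eq card_gt_0_iff)
  have fin: "finite X" "finite S" "finite Y"
    using finite_V by (simp_all add: X_def S_def Y_def)
  have "V = X \<union> S \<union> Y"
    by (auto simp: X_def S_def Y_def D_def d_def)
  moreover have "X \<inter> S = {}" "(X \<union> S) \<inter> Y = {}"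
    by (auto simp: X_def S_def Y_def D_def d_def)
  ultimately have V: "(\<Sum>x\<in>V. d x) = (\<Sum>x\<in>X. d x) + (\<Sum>x\<in>S. d x) + (\<Sum>x\<in>Y. d x)"
    using fin by (simp add: sum.union_disjoint)
  have "(\<Sum>x\<in>S. d x) \<le> real (card S) * real D"
    by (intro sum_bounded_above) (simp add: S_def d_def)
  also have "\<dots> \<le> n * real D"
    unfolding n_def using finite_V by (intro mult_right_mono of_nat_mono card_mono) (auto simp: S_def)
  also have "\<dots> \<le> n powr (5 / 4) * real D"
    using n powr_mono[of 1 "5 / 4" n] by (intro mult_right_mono) auto
  finally have S: "(\<Sum>x\<in>S. d x) \<le> real D * n powr (5 / 4)"
    by (simp add: mult_ac)
  have exponent: "real r * (1 - 1 / (4 * real r)) = real r - 1 / 4"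
    using r by (simp add: field_simps)
  \<comment> \<open>Each vertex of \<open>Y\<close> contributes at least
    \<open>n powr (r - 1 / 4)\<close> to a sum of at most \<open>2 * m * n ^ r\<close>.\<close>
  have "real (card Y) * n powr (real r - 1 / 4) = (\<Sum>x\<in>Y. (n powr (1 - 1 / (4 * real r))) ^ r)"
    using n by (simp add: powr_power exponent)
  also have "\<dots> \<le> (\<Sum>x\<in>Y. d x ^ r)"
    by (intro sum_mono power_mono) (auto simp: Y_def)
  also have "\<dots> = real (\<Sum>x\<in>Y. card (N x) ^ r)"
    by (simp add: d_def)
  also have "\<dots> \<le> real (2 * m * card (light Y))"
    by (intro of_nat_mono sum_degree_power_le) (auto simp: Y_def D_def)
  also have "\<dots> \<le> real (2 * m * card V ^ r)"
    unfolding card_tuples[OF finite_V, symmetric] using finite_V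
    by (intro of_nat_mono mult_left_mono card_mono) (auto simp: light_def finite_tuples)
  also have "\<dots> = 2 * real m * n powr (1 / 4) * n powr (real r - 1 / 4)"
    using n by (simp add: n_def powr_realpow flip: powr_add)
  finally have "real (card Y) \<le> 2 * real m * n powr (1 / 4)"
    using n by simp
  then have "real (card Y) * n \<le> 2 * real m * n powr (1 / 4) * n powr 1"
    using n by (intro mult_mono) auto
  also have "\<dots> = 2 * real m * n powr (5 / 4)"
    unfolding mult.assoc powr_add[symmetric] by simp
  finally have "real (card Y) * n \<le> 2 * real m * n powr (5 / 4)" .
  moreover have "(\<Sum>x\<in>Y. d x) \<le> real (card Y) * n"
    unfolding d_def n_def using finite_V N_subset by (intro sum_bounded_above of_nat_mono card_mono)
  moreover have "real (card (hedges G)) \<le> (\<Sum>x\<in>V. d x)"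
    using card_hedges_le by (simp add: d_def flip: of_nat_sum)
  ultimately show ?thesis
    using V S by (simp add: d_def D_def distrib_right)
qed

text \<open>With more edges, \<open>card_light_sparse\<close> would give
  \<open>n powr (q - c / 2) \<le> B * n powr (q - c)\<close>, although
  \<open>B < n powr (c / 2)\<close>.\<close>

lemma card_hedges_le_powr: "real (card (hedges G)) \<le> C * real (card V) powr (2 - 1 / real r - \<delta>)"
proof (rule ccontr)
  define n where "n = real (card V)"
  define q where "q = r * t"
  define c where "c = 1 / (4 * real r)"
  define \<beta> where "\<beta> = 2 - 1 / real r - \<delta>"
  define X where "X = {x \<in> V. (r * t)\<^sup>2 * 2 ^ (t ^ r) < card (N x) \<and> real (card (N x)) \<le> n powr (1 - 1 / (4 * real r))}"
  define d where "d x = real (card (N x))" for x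
  assume "\<not> ?thesis"
  then have many: "C * n powr \<beta> < real (card (hedges G))"
    by (simp add: n_def \<beta>_def)
  have edges_le: "real (card (hedges G)) \<le> n ^ 2"
  proof -
    have "card (hedges G) \<le> (\<Sum>x\<in>V. card V)"
      using finite_V N_subset by (intro order_trans[OF card_hedges_le] sum_mono card_mono)
    then show ?thesis
      by (simp add: n_def power2_eq_square flip: of_nat_mult)
  qed
  have "V \<noteq> {}"
  proof
    assume "V = {}"
    then show False
      using many edges_le by (simp add: n_def)
  qed
  then have n: "1 \<le> n"
    using finite_V by (simp add: n_def Suc_le_eq card_gt_0_iff)
  have c: "0 < c" "c \<le> 1" "c * real r = 1 / 4"
    using r by (auto simp: c_def field_simps)
  have rd: "real t ^ r * (real r * \<delta>) = c / 2"
    using r t by (simp add: \<delta>_def c_def field_simps power2_eq_square)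
  have "1 / real r \<le> 1 / 2"
    using r by (simp add: field_simps)
  moreover have "\<delta> \<le> 1 / 4"
  proof -
    have "1 * 1 \<le> real r ^ 2 * real (t ^ r)"
      using r t by (intro mult_mono) (auto simp: one_le_power)
    then show ?thesis
      using r t by (simp add: \<delta>_def field_simps)
  qed
  ultimately have \<beta>: "5 / 4 \<le> \<beta>"
    by (simp add: \<beta>_def)

  have B_less: "B < n powr (c / 2)"
  proof -
    have "B powr (16 * real r) \<le> C * 1"
      by (simp add: C_def)
    also have "\<dots> \<le> C * n powr \<beta>"
      using C_pos n \<beta> by (intro mult_left_mono ge_one_powr_ge_zero) auto
    also have "\<dots> < n powr 2"
      using many edges_le n by simp
    also have "\<dots> = (n powr (c / 2)) powr (16 * real r)"
    proof -
      have "c / 2 * (16 * real r) = 2"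
        using c(3) by simp
      then show ?thesis
        by (simp only: powr_powr)
    qed
    finally show ?thesis
      using B_pos r by (smt (verit, best) powr_mono2 of_nat_0_le_iff powr_ge_zero)
  qed

  have "n powr (5 / 4) \<le> n powr \<beta>"
    using n \<beta> by (intro powr_mono)
  then have "(real ((r * t)\<^sup>2 * 2 ^ (t ^ r)) + 2 * real m) * n powr (5 / 4)
      \<le> (real ((r * t)\<^sup>2 * 2 ^ (t ^ r)) + 2 * real m) * n powr \<beta>"
    by (intro mult_left_mono) simp_all
  moreover have "(real ((r * t)\<^sup>2 * 2 ^ (t ^ r)) + 4 * real m) * n powr \<beta> \<le> C * n powr \<beta>"
    by (intro mult_right_mono) (simp_all add: C_def)
  ultimately have sum_d: "2 * real m * n powr \<beta> \<le> (\<Sum>x\<in>X. d x)"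
    using many sum_middle_degrees_ge[OF \<open>V \<noteq> {}\<close>, folded n_def, folded X_def, folded d_def]
    by (simp add: distrib_right)

  have "X \<subseteq> V"
    by (auto simp: X_def)
  have light_le: "(\<Sum>x\<in>X. d x ^ r) \<le> 2 * real m * real (card (light X))"
  proof -
    have "(\<Sum>x\<in>X. card (N x) ^ r) \<le> 2 * m * card (light X)"
      by (rule sum_degree_power_le) (auto simp: X_def)
    then have "real (\<Sum>x\<in>X. card (N x) ^ r) \<le> real (2 * m * card (light X))"
      by (simp only: of_nat_le_iff)
    then show ?thesis
      by (simp add: d_def)
  qed
  have light_ge: "n powr (real r - real r * \<delta>) \<le> real (card (light X))"
  proof -
    \<comment> \<open>Extending the degrees by zero outside \<open>X\<close> lets the power mean run
      over \<open>V\<close>, so that the divisor is \<open>n\<close>.\<close>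
    define f where "f x = (if x \<in> X then d x else 0)" for x
    have exponent: "1 + real r * (\<beta> - 1) = real r - real r * \<delta>"
      using r by (simp add: \<beta>_def algebra_simps)
    have sums: "sum f V = sum d X" "(\<Sum>x\<in>V. f x ^ r) = (\<Sum>x\<in>X. d x ^ r)"
      using \<open>X \<subseteq> V\<close> finite_V r by (auto simp: f_def intro!: sum.mono_neutral_cong_right)
    have "2 * real m * n powr (real r - real r * \<delta>)
        \<le> (2 * real m) ^ r * n powr (real r - real r * \<delta>)"
      using m_pos r by (intro mult_right_mono self_le_power) auto
    also have "\<dots> = (2 * real m) ^ r * (n powr 1 * n powr (real r * (\<beta> - 1)))"
      by (simp only: exponent flip: powr_add)
    also have "\<dots> = n * (2 * real m * n powr \<beta> / n) ^ r"
    proof -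
      have "n powr (\<beta> - 1) = n powr \<beta> / n"
        using n by (simp add: powr_diff)
      then have "n powr (real r * (\<beta> - 1)) = (n powr \<beta> / n) ^ r"
        using n by (metis powr_power powr_eq_0_iff not_one_le_zero)
      then show ?thesis
        using n by (simp add: power_mult_distrib power_divide)
    qed
    also have "\<dots> \<le> n * (sum f V / n) ^ r"
      using n sum_d sums(1) by (intro mult_left_mono power_mono divide_right_mono) auto
    also have "\<dots> \<le> (\<Sum>x\<in>V. f x ^ r)"
      unfolding n_def by (rule power_mean_le) (simp add: f_def d_def)
    finally have "2 * real m * n powr (real r - real r * \<delta>) \<le> 2 * real m * real (card (light X))"
      using light_le sums(2) by linarith
    then show ?thesis
      using m_pos by simp
  qed

  have "n powr (real q - c / 2) \<le> n ^ q * (real (card (light X)) / n ^ r) ^ (t ^ r)"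
  proof -
    have "n powr (real q - c / 2) = n ^ q * (n powr (real r - real r * \<delta>) / n ^ r) ^ (t ^ r)"
    proof -
      have "n powr (real r - real r * \<delta>) / n ^ r = n powr (- (real r * \<delta>))"
        using n by (simp add: powr_diff powr_minus_divide powr_realpow)
      then have "(n powr (real r - real r * \<delta>) / n ^ r) ^ (t ^ r) = n powr (- (c / 2))"
        using n by (simp add: powr_power rd)
      then show ?thesis
        using n by (simp add: powr_diff powr_minus_divide powr_realpow)
    qed
    also have "\<dots> \<le> n ^ q * (real (card (light X)) / n ^ r) ^ (t ^ r)"
      using n light_ge by (intro mult_left_mono power_mono divide_right_mono) auto
    finally show ?thesis .
  qed
  also have "\<dots> \<le> real (q\<^sup>2) * n * n ^ (q - 2) + real (q\<^sup>2) * (\<Sum>x\<in>X. d x) * n ^ (q - 2)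
      + real (q ^ Suc r) * (\<Sum>x\<in>X. d x ^ Suc r) * n ^ (q - Suc r)"
    using card_light_sparse[OF \<open>V \<noteq> {}\<close> \<open>X \<subseteq> V\<close>] by (simp add: n_def d_def q_def)
  also have "\<dots> \<le> real (q\<^sup>2) * n powr (real q - c) + real (q\<^sup>2) * n powr (real q - c)
      + real (q ^ Suc r) * (2 * real m * n powr (real q - c))"
  proof -
    have "2 * r \<le> q"
      using t by (simp add: q_def)
    then have q: "2 \<le> q" "Suc r \<le> q"
      using r by linarith+
    have d_le: "d x \<le> n powr (1 - c)" if "x \<in> X" for x
      using that by (simp add: X_def d_def c_def)
    have "n * n ^ (q - 2) = n powr (1 + real (q - 2))"
      using n by (simp add: powr_add powr_realpow)
    also have "\<dots> \<le> n powr (real q - c)"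
      using n q c(2) by (intro powr_mono) auto
    finally have 1: "n * n ^ (q - 2) \<le> n powr (real q - c)" .
    have "(\<Sum>x\<in>X. d x) \<le> real (card X) * n powr (1 - c)"
      using d_le by (rule sum_bounded_above)
    also have "\<dots> \<le> n * n powr (1 - c)"
      unfolding n_def using \<open>X \<subseteq> V\<close> finite_V by (intro mult_right_mono of_nat_mono card_mono) auto
    finally have "(\<Sum>x\<in>X. d x) * n ^ (q - 2) \<le> n * n powr (1 - c) * n ^ (q - 2)"
      using n by (intro mult_right_mono) auto
    also have "\<dots> = n powr (1 + (1 - c) + real (q - 2))"
      using n by (simp only: powr_add powr_realpow powr_one)
    also have "\<dots> = n powr (real q - c)"
      using q by (simp add: of_nat_diff)
    finally have 2: "(\<Sum>x\<in>X. d x) * n ^ (q - 2) \<le> n powr (real q - c)" .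
    \<comment> \<open>One factor \<open>d x\<close> is at most \<open>n powr (1 - c)\<close>, which
      saves \<open>c\<close>; the other \<open>r\<close> factors are summed by
      \<open>light_le\<close>.\<close>
    have "(\<Sum>x\<in>X. d x ^ Suc r) \<le> (\<Sum>x\<in>X. n powr (1 - c) * d x ^ r)"
      using d_le by (auto intro!: sum_mono mult_right_mono simp: d_def)
    also have "\<dots> \<le> n powr (1 - c) * (2 * real m * real (card (light X)))"
      unfolding sum_distrib_left[symmetric] using light_le by (intro mult_left_mono) auto
    also have "\<dots> \<le> n powr (1 - c) * (2 * real m * n ^ r)"
    proof -
      have "card (light X) \<le> card (tuples V r)"
        using finite_V by (intro card_mono) (auto simp: light_def finite_tuples)
      then have "real (card (light X)) \<le> n ^ r"
        by (simp add: card_tuples finite_V n_def flip: of_nat_power)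
      then show ?thesis
        by (intro mult_left_mono) auto
    qed
    finally have "(\<Sum>x\<in>X. d x ^ Suc r) * n ^ (q - Suc r)
        \<le> n powr (1 - c) * (2 * real m * n ^ r) * n ^ (q - Suc r)"
      using n by (intro mult_right_mono) auto
    also have "\<dots> = 2 * real m * n powr (1 - c + real r + real (q - Suc r))"
      using n by (simp add: powr_add powr_realpow)
    also have "\<dots> = 2 * real m * n powr (real q - c)"
      using q by (simp add: of_nat_diff)
    finally have 3: "(\<Sum>x\<in>X. d x ^ Suc r) * n ^ (q - Suc r) \<le> 2 * real m * n powr (real q - c)" .
    show ?thesis
      unfolding mult.assoc[of "real _"] using 1 2 3 by (intro add_mono mult_left_mono) auto
  qed
  also have "\<dots> = B * n powr (real q - c)"
    by (simp add: B_def q_def distrib_right)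
  also have "\<dots> < n powr (c / 2) * n powr (real q - c)"
    using B_less n by (intro mult_strict_right_mono) auto
  also have "\<dots> = n powr (real q - c / 2)"
    by (simp flip: powr_add)
  finally show False
    by simp
qed

end

theorem theorem6p2:
  fixes r t :: nat
  assumes "r \<ge> 2" and "t \<ge> 2"
  shows "\<exists>C \<delta> :: real. C > 0 \<and> \<delta> > 0 \<and>
    (\<forall>n :: nat.
       real (extremal_number n (hypergraph_subdivision (complete_partite_hypergraph r t)))
         \<le> C * real n powr (2 - 1 / real r - \<delta>))"
proof -
  let ?H = "hypergraph_subdivision (complete_partite_hypergraph r t)"
  \<comment> \<open>These constants depend on \<open>r\<close> and \<open>t\<close> only, so they
    are fixed before \<open>n\<close> and \<open>G\<close>.\<close>
  let ?C = "subdivision_free_graph.C r t" and ?\<delta> = "subdivision_free_graph.\<delta> r t"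
  \<comment> \<open>Positivity of the constants is available only for a given graph in the locale;
    the extremal graph supplies one.\<close>
  have bound: "real (card (hedges G)) \<le> ?C * real (card (hverts G)) powr (2 - 1 / real r - ?\<delta>)
      \<and> 0 < ?C \<and> 0 < ?\<delta>"
    if "finite_simple_graph G" "\<not> contains_copy G ?H" for G :: "nat hypergraph"
  proof -
    interpret subdivision_free_graph G r t
      using assms that by unfold_locales
    show ?thesis
      using card_hedges_le_powr C_pos delta_pos by blast
  qed
  have ne: "hedges ?H \<noteq> {}"
    using assms by (intro hedges_subdivision_complete_partite) auto
  have "real (extremal_number n ?H) \<le> ?C * real n powr (2 - 1 / real r - ?\<delta>) \<and> 0 < ?C \<and> 0 < ?\<delta>" for n
  proof -
    have "extremal_number n ?H \<in> {card (hedges G) |G :: nat hypergraph.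
        finite_simple_graph G \<and> card (hverts G) = n \<and> \<not> contains_copy G ?H}"
      unfolding extremal_number_def
      using finite_extremal_set extremal_set_nonempty[OF ne] by (rule Max_in)
    then obtain G :: "nat hypergraph" where "extremal_number n ?H = card (hedges G)"
      "finite_simple_graph G" "card (hverts G) = n" "\<not> contains_copy G ?H"
      by blast
    then show ?thesis
      using bound[of G] by simp
  qed
  then show ?thesis
    by blast
qed

end
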